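(* Let $n>1$ and let $A(1),A(2),\ldots$ be a sequence of real $n\times n$ matrices, $A(t)=[a_{ij}(t)]$, such that for all $t\ge 1$ and $i\in[n]$ one has $a_{ii}(t)>0$ and $\sum_{j=1}^n|a_{ij}(t)|=1$, and let $\beta>0$ be a number such that $|a_{ij}(t)|\ge\beta$ whenever $|a_{ij}(t)|>0$, for all $i,j\in[n]$ and $t\ge 1$. Suppose that for each $t\ge 1$ the signed digraph $\mathbb{G}(t)$ of $A(t)$ is strongly connected and structurally unbalanced. Let $\bar A(t)$ be the $2n\times 2n$ stochastic matrix associated with $A(t)$, let $\bar\delta>0$ be a uniform lower bound on the entries of the absolute probability sequence for $\{\bar A(t)\}$, and let $\bar p^*=\max_t\bar p^*(t)$, where $\bar p^*(t)$ is the length of the longest shortest directed path of spanning trees contained in the graph of $\bar A(t)$. Then every solution of $x(t+1)=A(t)x(t)$, $t\ge 1$, $x(t)\in\mathbb{R}^n$, converges to zero as fast as $\bar\rho^{\,t}$ converges to zero, where $$\bar\rho=1-\frac{\bar\delta\beta^2}{4\bar p^*}.$$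
   Context: $[n]=\{1,\ldots,n\}$. The signed digraph of $A(t)$ has vertex set $[n]$ and an arc $(i,j)$ from $i$ to $j$ exactly when $a_{ji}(t)\neq 0$; the sign of $(i,j)$ is the sign of $a_{ji}(t)$. A digraph is strongly connected if (ignoring signs) there is a directed path between each ordered pair of distinct vertices. A signed digraph is structurally balanced if its vertices can be partitioned into two sets (one possibly empty) such that each arc connecting two vertices in the same set is positive and each arc connecting two vertices in different sets is negative; otherwise it is structurally unbalanced. The matrix $\bar A(t)=[\bar a_{ij}(t)]\in\mathbb{R}^{2n\times 2n}$ is defined for $i,j\in[n]$ by $\bar a_{ij}(t)=\bar a_{i+n,j+n}(t)=\max\{0,a_{ij}(t)\}$ and $\bar a_{i+n,j}(t)=\bar a_{i,j+n}(t)=\max\{0,-a_{ij}(t)\}$. It is a (row) stochastic matrix. The graph of $\bar A(t)$ is the unsigned digraph with vertex set $[2n]$ having an arc $(i,j)$ from $i$ to $j$ exactly when $\bar a_{ji}(t)\ne 0$. An absolute probability sequence for a sequence $\{S(t)\}_{t\ge1}$ of stochastic matrices is a sequence of stochastic (probability) vectors $\{\pi(t)\}_{t\ge 1}$ with $\pi'(t)=\pi'(t+1)S(t)$ for all $t\ge 1$ (prime denotes transpose). "$\bar\delta$ is a uniform lower bound on the entries" means $\pi_i(t)\ge\bar\delta$ for all $i\in[2n]$ and $t\ge 1$. $\bar p^*(t)$ is the maximum, over ordered pairs $(u,v)$ of vertices of the graph of $\bar A(t)$, of the length of a shortest directed path from $u$ to $v$ (equivalently, the length of the longest root-to-vertex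 path among all shortest-path spanning trees of that graph). "$x(t)$ converges to zero as fast as $\bar\rho^{\,t}$" means that there is a constant $C\ge 0$ (depending on $x(1)$) with $\|x(t)\|\le C\bar\rho^{\,t}$ for all $t\ge 1$. *)

theory Defs
  imports "HOL-Analysis.Analysis" "Graph_Theory.Graph_Theory"
begin

text \<open>
  Note the transposition: the arc from \<open>i\<close> to \<open>j\<close> is governed by the entry in
  row \<open>j\<close> and column \<open>i\<close>.
\<close>

definition matrix_digraph :: "real^'a^'a \<Rightarrow> ('a, 'a \<times> 'a) pre_digraph" where
  "matrix_digraph M =
    \<lparr>verts = UNIV, arcs = {(i, j). M $ j $ i \<noteq> 0}, tail = fst, head = snd\<rparr>"

definition arc_sign :: "real^'a^'a \<Rightarrow> 'a \<times> 'a \<Rightarrow> real" where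
  "arc_sign M = (\<lambda>(i, j). sgn (M $ j $ i))"

text \<open>A signed digraph is given by a digraph together with a sign function on its arcs.\<close>

definition structurally_balanced :: "('a, 'b) pre_digraph \<Rightarrow> ('b \<Rightarrow> real) \<Rightarrow> bool" where
  "structurally_balanced G s \<longleftrightarrow>
    (\<exists>V W. V \<union> W = verts G \<and> V \<inter> W = {} \<and>
      (\<forall>e \<in> arcs G.
        (tail G e \<in> V \<and> head G e \<in> V \<or> tail G e \<in> W \<and> head G e \<in> W \<longrightarrow> s e > 0) \<and>
        (tail G e \<in> V \<and> head G e \<in> W \<or> tail G e \<in> W \<and> head G e \<in> V \<longrightarrow> s e < 0)))"

text \<open>
  The index set \<open>{1..2n}\<close> is represented by the sum type \<open>'n + 'n\<close>:
  \<open>Inl i\<close> stands for \<open>i\<close> and \<open>Inr i\<close> for \<open>i + n\<close>.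
\<close>

definition bar_matrix :: "real^'n^'n \<Rightarrow> real^('n + 'n)^('n + 'n)" where
  "bar_matrix A = (\<chi> k l.
    case k of
      Inl i \<Rightarrow> (case l of Inl j \<Rightarrow> max 0 (A $ i $ j) | Inr j \<Rightarrow> max 0 (- (A $ i $ j)))
    | Inr i \<Rightarrow> (case l of Inl j \<Rightarrow> max 0 (- (A $ i $ j)) | Inr j \<Rightarrow> max 0 (A $ i $ j)))"

definition probability_vector :: "real^'m \<Rightarrow> bool" where
  "probability_vector v \<longleftrightarrow> (\<forall>i. 0 \<le> v $ i) \<and> (\<Sum>i\<in>UNIV. v $ i) = 1"

text \<open>Time starts at 1 throughout; the value of a sequence at 0 is irrelevant.\<close>

definition absolute_probability_sequence ::
    "(nat \<Rightarrow> real^'m^'m) \<Rightarrow> (nat \<Rightarrow> real^'m) \<Rightarrow> bool" where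
  "absolute_probability_sequence S \<pi> \<longleftrightarrow>
    (\<forall>t\<ge>1. probability_vector (\<pi> t) \<and> \<pi> t = \<pi> (t + 1) v* S t)"

text \<open>
  The next three definitions are meaningful only for strongly connected digraphs: otherwise
  the \<open>LEAST\<close> below may be taken over the empty set. The maximum in \<open>max_path_length\<close> is then
  over a set of naturals bounded by the number of vertices, although over infinitely many times.
\<close>

definition shortest_path_length :: "('a, 'b) pre_digraph \<Rightarrow> 'a \<Rightarrow> 'a \<Rightarrow> nat" where
  "shortest_path_length G u v = (LEAST k. \<exists>p. pre_digraph.apath G u p v \<and> length p = k)"

definition longest_shortest_path :: "('a, 'b) pre_digraph \<Rightarrow> nat" where
  "longest_shortest_path G =
    Max {shortest_path_length G u v | u v. u \<in> verts G \<and> v \<in> verts G}"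

definition max_path_length :: "(nat \<Rightarrow> real^'m^'m) \<Rightarrow> nat" where
  "max_path_length S = Max {longest_shortest_path (matrix_digraph (S t)) | t. t \<ge> 1}"

end

theory Submission
  imports Defs
begin

text \<open>
  Put \<open>z = (x, -x)\<close>. Splitting every entry of \<open>A t\<close> into its positive and negative part turns
  \<open>x (t + 1) = A t *v x t\<close> into the averaging dynamics \<open>z (t + 1) = bar_matrix (A t) *v z t\<close>,
  whose matrices are stochastic. Two facts then give the theorem.

  First, the graph of \<open>bar_matrix A\<close> is the double cover of the signed graph of \<open>A\<close>, in which a
  negative arc changes the sheet. If no vertex could reach its own copy in the other sheet, the
  sheet in which a vertex is reached from a fixed root would be a balanced bipartition; so
  structural imbalance makes the double cover strongly connected
  (\<open>strongly_connected_bar_matrix\<close>).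

  Second, averaging dynamics with strongly connected graphs reach consensus at the claimed rate
  (\<open>converges_to_mean_exponentially\<close>). The mean \<open>\<pi> t \<bullet> z t\<close> is a constant \<open>c\<close>, and the
  Lyapunov function is the variance of \<open>z t\<close> under the weights \<open>\<pi> t\<close>. By the law of total variance
  it drops in one step by the \<open>\<pi> (t + 1)\<close>-average of the variances of \<open>z t\<close> under the rows of the
  matrix. That drop is at least \<open>\<delta> \<beta>\<^sup>2 D\<close>, where the disagreement \<open>D\<close> is the sum of the squared
  differences of \<open>z t\<close> along the arcs (\<open>variance_decrease\<close>). Along a shortest path of length at
  most \<open>p\<close>, Cauchy-Schwarz bounds every squared difference of two coordinates by \<open>p D\<close>
  (\<open>sq_diff_le_disagreement\<close>), so the variance is at most \<open>p D / 2\<close> and shrinks by the factor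
  \<open>1 - 2 \<delta> \<beta>\<^sup>2 / p \<le> \<rho>\<^sup>2\<close>. Since \<open>\<pi> t\<close> is bounded below by \<open>\<delta>\<close>, each coordinate of \<open>z t\<close>
  is within \<open>O(\<rho> ^ t)\<close> of \<open>c\<close>.

  Finally \<open>x t\<close> and \<open>- x t\<close> both converge to \<open>c\<close> in every coordinate, which forces \<open>c = 0\<close>.
\<close>

section \<open>Variance under probability weights\<close>

definition variance :: "real^'m::finite \<Rightarrow> real^'m \<Rightarrow> real" where
  "variance w z = (\<Sum>i\<in>UNIV. w $ i * (z $ i)\<^sup>2) - (w \<bullet> z)\<^sup>2"

lemma variance_eq_pairwise:
  fixes w z :: "real^'m::finite"
  assumes "probability_vector w"
  shows "variance w z = (\<Sum>i\<in>UNIV. \<Sum>j\<in>UNIV. w $ i * w $ j * (z $ i - z $ j)\<^sup>2) / 2"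
proof -
  have one: "(\<Sum>i\<in>UNIV. w $ i) = 1"
    using assms by (simp add: probability_vector_def)
  define q where "q = (\<Sum>i\<in>UNIV. w $ i * (z $ i)\<^sup>2)"
  have "(\<Sum>i\<in>UNIV. \<Sum>j\<in>UNIV. w $ i * w $ j * (z $ i - z $ j)\<^sup>2) =
      (\<Sum>i\<in>UNIV. \<Sum>j\<in>UNIV. (w $ i * (z $ i)\<^sup>2) * w $ j + w $ i * (w $ j * (z $ j)\<^sup>2)
          - 2 * (w $ i * z $ i) * (w $ j * z $ j))"
    by (intro sum.cong refl) (simp add: power2_eq_square algebra_simps)
  also have "\<dots> = (\<Sum>i\<in>UNIV. (w $ i * (z $ i)\<^sup>2) * 1 + w $ i * q
          - 2 * (w $ i * z $ i) * (w \<bullet> z))"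
    by (simp add: sum.distrib sum_subtractf one q_def inner_vec_def flip: sum_distrib_left)
  also have "\<dots> = q + q - 2 * (w \<bullet> z) * (w \<bullet> z)"
    by (simp add: sum.distrib sum_subtractf one inner_vec_def
        flip: sum_distrib_left sum_distrib_right q_def)
  finally show ?thesis
    by (simp add: variance_def q_def power2_eq_square)
qed

lemma variance_eq_deviation:
  fixes w z :: "real^'m::finite"
  assumes "probability_vector w"
  shows "variance w z = (\<Sum>i\<in>UNIV. w $ i * (z $ i - w \<bullet> z)\<^sup>2)"
proof -
  define c where "c = w \<bullet> z"
  have one: "(\<Sum>i\<in>UNIV. w $ i) = 1"
    using assms by (simp add: probability_vector_def)
  have "(\<Sum>i\<in>UNIV. w $ i * (z $ i - c)\<^sup>2) =
      (\<Sum>i\<in>UNIV. w $ i * (z $ i)\<^sup>2 + w $ i * c\<^sup>2 - 2 * c * (w $ i * z $ i))"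
    by (intro sum.cong refl) (simp add: power2_eq_square algebra_simps)
  also have "\<dots> = (\<Sum>i\<in>UNIV. w $ i * (z $ i)\<^sup>2) + 1 * c\<^sup>2 - 2 * c * c"
    by (simp add: sum.distrib sum_subtractf one c_def inner_vec_def
        flip: sum_distrib_left sum_distrib_right)
  finally show ?thesis
    by (simp add: variance_def c_def power2_eq_square)
qed

text \<open>
  In the double sum of \<open>variance_eq_pairwise\<close> the pairs containing \<open>i\<close> occur twice, which cancels
  the factor one half; all other terms are nonnegative and are dropped. For a row of a stochastic
  matrix with \<open>i\<close> the diagonal position, only the arcs into \<open>i\<close> remain.
\<close>

lemma variance_ge_self_weight:
  fixes w z :: "real^'m::finite"
  assumes w: "probability_vector w"
  shows "variance w z \<ge> w $ i * (\<Sum>j\<in>UNIV. w $ j * (z $ i - z $ j)\<^sup>2)"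
proof -
  define f where "f = (\<lambda>k j. w $ k * w $ j * (z $ k - z $ j)\<^sup>2)"
  have nn: "f k j \<ge> 0" for k j
    using w by (simp add: f_def probability_vector_def)
  have sym: "f k j = f j k" for k j
    by (simp add: f_def power2_commute mult.commute)
  have "(\<Sum>k\<in>UNIV. \<Sum>j\<in>UNIV. f k j) = (\<Sum>j\<in>UNIV. f i j) + (\<Sum>k\<in>UNIV - {i}. \<Sum>j\<in>UNIV. f k j)"
    by (simp add: sum.remove[of _ i])
  also have "\<dots> \<ge> (\<Sum>j\<in>UNIV. f i j) + (\<Sum>k\<in>UNIV - {i}. f k i)"
    by (intro add_left_mono sum_mono member_le_sum) (auto simp: nn)
  also (xtrans) have "(\<Sum>k\<in>UNIV - {i}. f k i) = (\<Sum>k\<in>UNIV. f i k)"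
    unfolding sym[of i] by (rule sum.mono_neutral_left) (auto simp: f_def)
  finally have "(\<Sum>k\<in>UNIV. \<Sum>j\<in>UNIV. f k j) / 2 \<ge> (\<Sum>j\<in>UNIV. f i j)"
    by simp
  also have "(\<Sum>j\<in>UNIV. f i j) = w $ i * (\<Sum>j\<in>UNIV. w $ j * (z $ i - z $ j)\<^sup>2)"
    by (simp add: f_def sum_distrib_left mult.assoc)
  finally show ?thesis
    by (simp add: variance_eq_pairwise[OF w] f_def)
qed

lemma variance_le_max_gap:
  fixes w z :: "real^'m::finite"
  assumes w: "probability_vector w" and gap: "\<And>i j. (z $ i - z $ j)\<^sup>2 \<le> b"
  shows "variance w z \<le> b / 2"
proof -
  have "(\<Sum>i\<in>UNIV. \<Sum>j\<in>UNIV. w $ i * w $ j * (z $ i - z $ j)\<^sup>2)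
      \<le> (\<Sum>i\<in>UNIV. \<Sum>j\<in>UNIV. w $ i * w $ j * b)"
    using w by (intro sum_mono mult_left_mono gap) (simp add: probability_vector_def)
  also have "\<dots> = b"
    using w by (simp add: probability_vector_def flip: sum_distrib_left sum_distrib_right)
  finally show ?thesis
    by (simp add: variance_eq_pairwise[OF w])
qed

section \<open>Decrease of the variance in one averaging step\<close>

text \<open>
  The unweighted Dirichlet form of the graph of \<open>S\<close>: it links the graph to the decrease of the
  variance, on one side, and to the spread of \<open>z\<close>, on the other.
\<close>

definition disagreement :: "real^'m::finite^'m \<Rightarrow> real^'m \<Rightarrow> real" where
  "disagreement S z = (\<Sum>(j, i) \<in> arcs (matrix_digraph S). (z $ i - z $ j)\<^sup>2)"

lemma disagreement_eq_row_sum: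
  "disagreement S z = (\<Sum>i\<in>UNIV. \<Sum>j | S $ i $ j \<noteq> 0. (z $ i - z $ j)\<^sup>2)"
proof -
  have "(\<Sum>i\<in>UNIV. \<Sum>j | S $ i $ j \<noteq> 0. (z $ i - z $ j)\<^sup>2) =
      (\<Sum>(i, j) \<in> Sigma UNIV (\<lambda>i. {j. S $ i $ j \<noteq> 0}). (z $ i - z $ j)\<^sup>2)"
    by (simp add: sum.Sigma)
  also have "\<dots> = disagreement S z"
    unfolding disagreement_def matrix_digraph_def
    by (rule sum.reindex_bij_witness[of _ prod.swap prod.swap]) auto
  finally show ?thesis ..
qed

text \<open>
  Read backwards in time, \<open>\<pi> t = \<pi> (t + 1) v* S t\<close> says that averaging with \<open>S t\<close> and then with
  \<open>\<pi> (t + 1)\<close> is averaging with \<open>\<pi> t\<close>.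
\<close>

lemma mean_step:
  fixes \<pi> :: "nat \<Rightarrow> real^'m::finite"
  assumes "absolute_probability_sequence S \<pi>" "t \<ge> 1"
  shows "\<pi> (t + 1) \<bullet> (S t *v z) = \<pi> t \<bullet> z"
proof -
  have "\<pi> t = \<pi> (t + 1) v* S t"
    using assms unfolding absolute_probability_sequence_def by blast
  then show ?thesis
    by (metis dot_lmul_matrix)
qed

text \<open>
  The law of total variance: the second moment of \<open>z\<close> under \<open>\<pi> t\<close> splits over the rows of \<open>S t\<close>
  by \<open>mean_step\<close>, applied to the vector of squares, while the squared means agree.
\<close>

lemma variance_step:
  fixes \<pi> :: "nat \<Rightarrow> real^'m::finite"
  assumes \<pi>: "absolute_probability_sequence S \<pi>" and t: "t \<ge> 1"
  shows "variance (\<pi> t) z =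
    variance (\<pi> (t + 1)) (S t *v z) + (\<Sum>i\<in>UNIV. \<pi> (t + 1) $ i * variance (S t $ i) z)"
proof -
  define sq where "sq = (\<lambda>y :: real^'m. \<chi> i. (y $ i)\<^sup>2)"
  have q: "(\<Sum>i\<in>UNIV. w $ i * (y $ i)\<^sup>2) = w \<bullet> sq y" for w y :: "real^'m"
    by (simp add: sq_def inner_vec_def)
  have "variance (\<pi> t) z = \<pi> (t + 1) \<bullet> (S t *v sq z) - (\<pi> (t + 1) \<bullet> (S t *v z))\<^sup>2"
    unfolding mean_step[OF assms] by (simp add: variance_def q)
  moreover have "variance (\<pi> (t + 1)) (S t *v z) =
      \<pi> (t + 1) \<bullet> sq (S t *v z) - (\<pi> (t + 1) \<bullet> (S t *v z))\<^sup>2"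
    by (simp add: variance_def q)
  moreover have "(\<Sum>i\<in>UNIV. \<pi> (t + 1) $ i * variance (S t $ i) z) =
      \<pi> (t + 1) \<bullet> (S t *v sq z - sq (S t *v z))"
    by (simp add: variance_def q sq_def inner_vec_def[of "\<pi> (Suc t)"]
        matrix_vector_mul_component)
  ultimately show ?thesis
    by (simp add: inner_diff_right)
qed

text \<open>
  One factor \<open>\<beta>\<close> comes from the diagonal weight in \<open>variance_ge_self_weight\<close>, the other from the
  weight of the arc itself.
\<close>

lemma variance_decrease:
  fixes \<pi> :: "nat \<Rightarrow> real^'m::finite"
  assumes \<pi>: "absolute_probability_sequence S \<pi>" and t: "t \<ge> 1"
    and rows: "\<And>i. probability_vector (S t $ i)"
    and diag: "\<And>i. S t $ i $ i \<noteq> 0"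
    and entries: "\<And>i j. S t $ i $ j \<noteq> 0 \<Longrightarrow> \<beta> \<le> S t $ i $ j" and "\<beta> \<ge> 0"
    and \<delta>: "\<And>i. \<delta> \<le> \<pi> (t + 1) $ i" and "\<delta> \<ge> 0"
  shows "variance (\<pi> (t + 1)) (S t *v z) + \<delta> * \<beta>\<^sup>2 * disagreement (S t) z \<le> variance (\<pi> t) z"
proof -
  have nn: "S t $ i $ j \<ge> 0" for i j
    using rows by (simp add: probability_vector_def)
  have row: "\<beta>\<^sup>2 * (\<Sum>j | S t $ i $ j \<noteq> 0. (z $ i - z $ j)\<^sup>2) \<le> variance (S t $ i) z" for i
  proof -
    have "\<beta> * (\<Sum>j | S t $ i $ j \<noteq> 0. (z $ i - z $ j)\<^sup>2)
        \<le> (\<Sum>j | S t $ i $ j \<noteq> 0. S t $ i $ j * (z $ i - z $ j)\<^sup>2)"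
      unfolding sum_distrib_left by (intro sum_mono mult_right_mono) (auto intro: entries)
    also have "\<dots> \<le> (\<Sum>j\<in>UNIV. S t $ i $ j * (z $ i - z $ j)\<^sup>2)"
      by (intro sum_mono2) (auto simp: nn)
    finally have "\<beta> * (\<beta> * (\<Sum>j | S t $ i $ j \<noteq> 0. (z $ i - z $ j)\<^sup>2))
        \<le> S t $ i $ i * (\<Sum>j\<in>UNIV. S t $ i $ j * (z $ i - z $ j)\<^sup>2)"
      by (intro mult_mono entries diag)
        (auto simp: nn \<open>\<beta> \<ge> 0\<close> intro!: mult_nonneg_nonneg sum_nonneg)
    also have "\<dots> \<le> variance (S t $ i) z"
      by (rule variance_ge_self_weight[OF rows])
    finally show ?thesis
      by (simp add: power2_eq_square mult.assoc)
  qed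
  have "\<delta> * \<beta>\<^sup>2 * disagreement (S t) z =
      (\<Sum>i\<in>UNIV. \<delta> * (\<beta>\<^sup>2 * (\<Sum>j | S t $ i $ j \<noteq> 0. (z $ i - z $ j)\<^sup>2)))"
    by (simp add: disagreement_eq_row_sum sum_distrib_left mult.assoc)
  also have "\<dots> \<le> (\<Sum>i\<in>UNIV. \<pi> (t + 1) $ i * variance (S t $ i) z)"
    by (intro sum_mono mult_mono row \<delta> order.trans[OF \<open>\<delta> \<ge> 0\<close> \<delta>])
      (auto intro!: mult_nonneg_nonneg sum_nonneg)
  finally show ?thesis
    using variance_step[OF \<pi> t, of z] by simp
qed

section \<open>Spread and disagreement on a strongly connected graph\<close>

lemma matrix_digraph_sel [simp]:
  "verts (matrix_digraph M) = UNIV"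
  "arcs (matrix_digraph M) = {(i, j). M $ j $ i \<noteq> 0}"
  "tail (matrix_digraph M) = fst"
  "head (matrix_digraph M) = snd"
  by (simp_all add: matrix_digraph_def)

lemma fin_digraph_matrix_digraph: "fin_digraph (matrix_digraph (M :: real^'m::finite^'m))"
  by unfold_locales (auto simp: matrix_digraph_def)

lemma reachable_matrix_digraph_iff:
  "u \<rightarrow>\<^sup>*\<^bsub>matrix_digraph M\<^esub> v \<longleftrightarrow> (u, v) \<in> {(i, j). M $ j $ i \<noteq> 0}\<^sup>*"
proof -
  have "arcs_ends (matrix_digraph M) = {(i, j). M $ j $ i \<noteq> 0}"
    by (simp add: arcs_ends_conv matrix_digraph_def)
  then show ?thesis
    by (auto simp: reachable_def matrix_digraph_def
      intro: rtrancl_on_rtranclI rtrancl_consistent_rtrancl_on)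
qed

text \<open>
  The difference telescopes along the path, and Cauchy-Schwarz applies to its arcs. Since the vertices
  of an \<open>apath\<close> are distinct, so are its arcs, and each occurs at most once in the disagreement.
\<close>

lemma sq_diff_le_disagreement_of_apath:
  fixes S :: "real^'m::finite^'m"
  assumes "pre_digraph.apath (matrix_digraph S) u p v"
  shows "(z $ v - z $ u)\<^sup>2 \<le> real (length p) * disagreement S z"
proof -
  interpret fin_digraph "matrix_digraph S"
    by (rule fin_digraph_matrix_digraph)
  have p: "set p \<subseteq> arcs (matrix_digraph S)" "cas u p v" "distinct p"
    using assms distinct_verts_imp_distinct[of u p v]
    by (auto simp: apath_def awalk_def simp del: matrix_digraph_sel)
  have "z $ v - z $ u = (\<Sum>(j, i) \<leftarrow> p. z $ i - z $ j)"
    using p(2) by (induction p arbitrary: u) (auto simp: algebra_simps)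
  also have "\<dots> = (\<Sum>(j, i) \<in> set p. z $ i - z $ j)"
    by (simp add: sum_list_distinct_conv_sum_set p(3))
  also have "\<dots>\<^sup>2 \<le> (\<Sum>e \<in> set p. (case e of (j, i) \<Rightarrow> z $ i - z $ j)\<^sup>2) * real (length p)"
    using sum_squared_le_sum_of_squares[where I = "set p"] distinct_card[OF p(3)] by metis
  also have "\<dots> \<le> disagreement S z * real (length p)"
    unfolding disagreement_def
    by (intro mult_right_mono order.trans[OF _ sum_mono2[OF finite_arcs p(1)]])
      (auto simp: case_prod_unfold)
  finally show ?thesis
    by (simp add: mult.commute)
qed

lemma shortest_path_length_apath:
  fixes S :: "real^'m::finite^'m"
  assumes "strongly_connected (matrix_digraph S)"
  obtains p where "pre_digraph.apath (matrix_digraph S) u p v"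
    "length p = shortest_path_length (matrix_digraph S) u v"
proof -
  interpret fin_digraph "matrix_digraph S"
    by (rule fin_digraph_matrix_digraph)
  have "u \<rightarrow>\<^sup>*\<^bsub>matrix_digraph S\<^esub> v"
    using assms by (auto simp: strongly_connected_def matrix_digraph_def)
  then obtain p where "apath u p v"
    by (auto simp: reachable_awalk intro: apath_awalk_to_apath)
  then have "\<exists>k p. apath u p v \<and> length p = k"
    by auto
  from LeastI_ex[OF this] show ?thesis
    using that unfolding shortest_path_length_def by blast
qed

lemma shortest_path_length_less_card:
  fixes S :: "real^'m::finite^'m"
  assumes "strongly_connected (matrix_digraph S)"
  shows "shortest_path_length (matrix_digraph S) u v < CARD('m)"
proof -
  interpret fin_digraph "matrix_digraph S"
    by (rule fin_digraph_matrix_digraph)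
  obtain p where "apath u p v" "length p = shortest_path_length (matrix_digraph S) u v"
    using shortest_path_length_apath[OF assms] .
  then show ?thesis
    using length_apath_less by (fastforce simp: matrix_digraph_def)
qed

text \<open>
  The maximum over all times is attained: the lengths stay below the number of vertices, so they form
  a finite set although the times do not.
\<close>

lemma shortest_path_length_le_max_path_length:
  fixes S :: "nat \<Rightarrow> real^'m::finite^'m"
  assumes sc: "\<And>t. t \<ge> 1 \<Longrightarrow> strongly_connected (matrix_digraph (S t))" and t: "t \<ge> 1"
  shows "shortest_path_length (matrix_digraph (S t)) u v \<le> max_path_length S"
proof -
  define L where "L = (\<lambda>t. {shortest_path_length (matrix_digraph (S t)) u v | u v.
      u \<in> verts (matrix_digraph (S t)) \<and> v \<in> verts (matrix_digraph (S t))})"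
  have mem: "shortest_path_length (matrix_digraph (S t)) u v \<in> L t" for t u v
    by (auto simp: L_def matrix_digraph_def)
  have bound: "L t \<subseteq> {..<CARD('m)}" if "t \<ge> 1" for t
    using shortest_path_length_less_card[OF sc[OF that]] by (auto simp: L_def)
  have fin: "finite (L t)" if "t \<ge> 1" for t
    using bound[OF that] finite_subset by blast
  have L: "longest_shortest_path (matrix_digraph (S t)) = Max (L t)" for t
    unfolding longest_shortest_path_def L_def ..
  have "longest_shortest_path (matrix_digraph (S t)) \<in> L t" if "t \<ge> 1" for t
    unfolding L using fin[OF that] mem by (intro Max_in) auto
  with bound have "{longest_shortest_path (matrix_digraph (S t)) | t. t \<ge> 1} \<subseteq> {..<CARD('m)}"
    by blast
  then have "longest_shortest_path (matrix_digraph (S t)) \<le> max_path_length S"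
    unfolding max_path_length_def using t by (intro Max_ge) (auto dest: finite_subset)
  moreover have "shortest_path_length (matrix_digraph (S t)) u v
      \<le> longest_shortest_path (matrix_digraph (S t))"
    unfolding L using mem fin[OF t] by (intro Max_ge)
  ultimately show ?thesis
    by linarith
qed

lemma sq_diff_le_disagreement:
  fixes S :: "nat \<Rightarrow> real^'m::finite^'m"
  assumes sc: "\<And>t. t \<ge> 1 \<Longrightarrow> strongly_connected (matrix_digraph (S t))" and t: "t \<ge> 1"
  shows "(z $ i - z $ j)\<^sup>2 \<le> real (max_path_length S) * disagreement (S t) z"
proof -
  obtain p where p: "pre_digraph.apath (matrix_digraph (S t)) j p i"
    "length p = shortest_path_length (matrix_digraph (S t)) j i"
    using shortest_path_length_apath[OF sc[OF t]] .
  then have "length p \<le> max_path_length S"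
    using shortest_path_length_le_max_path_length[OF sc t] by simp
  then have "real (length p) * disagreement (S t) z \<le> real (max_path_length S) * disagreement (S t) z"
    by (intro mult_right_mono) (auto simp: disagreement_def intro!: sum_nonneg)
  with sq_diff_le_disagreement_of_apath[OF p(1), of z] show ?thesis
    by linarith
qed

text \<open>
  A maximal length of zero would force every vector to be constant by \<open>sq_diff_le_disagreement\<close>; an
  indicator vector of a single vertex is not.
\<close>

lemma max_path_length_pos:
  fixes S :: "nat \<Rightarrow> real^'m::finite^'m"
  assumes sc: "\<And>t. t \<ge> 1 \<Longrightarrow> strongly_connected (matrix_digraph (S t))"
    and "CARD('m) > 1"
  shows "max_path_length S > 0"
proof -
  obtain i j :: 'm where "i \<noteq> j"
    using \<open>CARD('m) > 1\<close> by (metis (full_types) card_le_Suc0_iff_eq finite linorder_not_le One_nat_def)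
  then show ?thesis
    using sq_diff_le_disagreement[of S 1 "axis i 1" i j, OF sc] by (auto simp: axis_def intro: ccontr)
qed

section \<open>The double cover of a structurally unbalanced graph\<close>

text \<open>The deck transformation, which is an automorphism of the graph of \<open>bar_matrix A\<close>.\<close>

abbreviation sheet_swap :: "'n + 'n \<Rightarrow> 'n + 'n" where
  "sheet_swap \<equiv> case_sum Inr Inl"

text \<open>
  Every walk in the graph of \<open>A\<close> lifts to a walk that starts in a prescribed sheet, so each vertex is
  reached from each other one in at least one of its two copies. If some vertex \<open>r\<close> reaches its own
  copy in the other sheet, walks can be routed through \<open>r\<close> to end in either sheet. Otherwise each
  vertex is reached from a fixed root in exactly one sheet; positive arcs preserve that sheet and
  negative ones change it, which is structural balance.
\<close>

lemma strongly_connected_bar_matrix: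
  fixes A :: "real^'n^'n"
  assumes sc: "strongly_connected (matrix_digraph A)"
    and unbal: "\<not> structurally_balanced (matrix_digraph A) (arc_sign A)"
  shows "strongly_connected (matrix_digraph (bar_matrix A))"
proof -
  define R where "R = {(k, l). bar_matrix A $ l $ k \<noteq> 0}"
  have R_swap: "(sheet_swap k, sheet_swap l) \<in> R" if "(k, l) \<in> R" for k l
    using that by (auto simp: R_def bar_matrix_def split: sum.splits)
  have swap: "(sheet_swap k, sheet_swap l) \<in> R\<^sup>*" if "(k, l) \<in> R\<^sup>*" for k l
    using that by induction (auto intro: R_swap rtrancl_into_rtrancl)
  have swap_LL: "(Inr i, Inr j) \<in> R\<^sup>*" if "(Inl i, Inl j) \<in> R\<^sup>*" for i j
    using swap[OF that] by simp
  have swap_LR: "(Inr i, Inl j) \<in> R\<^sup>*" if "(Inl i, Inr j) \<in> R\<^sup>*" for i j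
    using swap[OF that] by simp
  have pos: "(Inl i, Inl j) \<in> R" "(Inr i, Inr j) \<in> R" if "A $ j $ i > 0" for i j
    using that by (auto simp: R_def bar_matrix_def)
  have neg: "(Inl i, Inr j) \<in> R" "(Inr i, Inl j) \<in> R" if "A $ j $ i < 0" for i j
    using that by (auto simp: R_def bar_matrix_def)
  have base: "(i, j) \<in> {(i, j). A $ j $ i \<noteq> 0}\<^sup>*" for i j
    using sc by (simp add: strongly_connected_def reachable_matrix_digraph_iff)
  have lift: "(Inl i, Inl j) \<in> R\<^sup>* \<or> (Inl i, Inr j) \<in> R\<^sup>*" for i j
    using base[of i j]
  proof induction
    case (step j k)
    then have "A $ k $ j > 0 \<or> A $ k $ j < 0"
      by auto
    with step.IH show ?case
      by (auto intro: pos neg rtrancl_into_rtrancl)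
  qed simp
  have "\<exists>r. (Inl r, Inr r) \<in> R\<^sup>*"
  proof (rule ccontr)
    assume "\<nexists>r. (Inl r, Inr r) \<in> R\<^sup>*"
    then have none: "(Inl r, Inr r) \<notin> R\<^sup>*" for r
      by blast
    \<comment> \<open>Any vertex can serve as the root of the bipartition.\<close>
    define r :: 'n where "r = undefined"
    define V where "V = {v. (Inl r, Inl v) \<in> R\<^sup>*}"
    define W where "W = {v. (Inl r, Inr v) \<in> R\<^sup>*}"
    have "V \<union> W = UNIV"
      using lift by (auto simp: V_def W_def)
    \<comment> \<open>Walking back from a common vertex of \<open>V\<close> and \<open>W\<close> to the root, in whichever sheet the
      lifted walk ends, connects the two copies of the root.\<close>
    have disj: "False" if "v \<in> V" "v \<in> W" for v
    proof -
      have "(Inr r, Inl v) \<in> R\<^sup>*" "(Inl r, Inl v) \<in> R\<^sup>*"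
        using that swap_LR by (auto simp: V_def W_def)
      with lift[of v r] have "(Inr r, Inl r) \<in> R\<^sup>* \<or> (Inl r, Inr r) \<in> R\<^sup>*"
        by (meson rtrancl_trans)
      then show False
        using none[of r] swap[of "Inr r" "Inl r"] by auto
    qed
    have same: "k \<in> V" if "j \<in> V" "A $ k $ j > 0" for j k
      using that pos by (auto simp: V_def intro: rtrancl_into_rtrancl)
    have same': "k \<in> W" if "j \<in> W" "A $ k $ j > 0" for j k
      using that pos by (auto simp: W_def intro: rtrancl_into_rtrancl)
    have flip: "k \<in> W" if "j \<in> V" "A $ k $ j < 0" for j k
      using that neg by (auto simp: V_def W_def intro: rtrancl_into_rtrancl)
    have flip': "k \<in> V" if "j \<in> W" "A $ k $ j < 0" for j k
      using that neg by (auto simp: V_def W_def intro: rtrancl_into_rtrancl)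
    have arc: "(j \<in> V \<and> k \<in> V \<or> j \<in> W \<and> k \<in> W \<longrightarrow> A $ k $ j > 0) \<and>
        (j \<in> V \<and> k \<in> W \<or> j \<in> W \<and> k \<in> V \<longrightarrow> A $ k $ j < 0)"
      if "A $ k $ j \<noteq> 0" for j k
    proof (cases "A $ k $ j > 0")
      case True
      then show ?thesis
        using same[of j k] same'[of j k] disj[of k] by blast
    next
      case False
      with that have "A $ k $ j < 0"
        by simp
      then show ?thesis
        using flip[of j k] flip'[of j k] disj[of k] by blast
    qed
    have "structurally_balanced (matrix_digraph A) (arc_sign A)"
      unfolding structurally_balanced_def
    proof (rule exI[of _ V], rule exI[of _ W], intro conjI ballI)
      show "V \<union> W = verts (matrix_digraph A)" "V \<inter> W = {}"
        using \<open>V \<union> W = UNIV\<close> disj by auto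
    qed (use arc in \<open>auto simp: arc_sign_def\<close>)
    with unbal show False ..
  qed
  then obtain r where LR: "(Inl r, Inr r) \<in> R\<^sup>*" ..
  then have RL: "(Inr r, Inl r) \<in> R\<^sup>*"
    by (rule swap_LR)
  have from_r: "(Inl r, k) \<in> R\<^sup>*" for k
  proof (cases k)
    case (Inl v)
    then show ?thesis
      using lift[of r v] LR swap_LR by (meson rtrancl_trans)
  next
    case (Inr v)
    then show ?thesis
      using lift[of r v] LR swap_LL by (meson rtrancl_trans)
  qed
  have to_r: "(k, Inl r) \<in> R\<^sup>*" for k
  proof (cases k)
    case (Inl v)
    then show ?thesis
      using lift[of v r] RL by (meson rtrancl_trans)
  next
    case (Inr v)
    then show ?thesis
      using lift[of v r] RL swap_LR swap_LL by (meson rtrancl_trans)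
  qed
  have "(k, l) \<in> R\<^sup>*" for k l
    using to_r from_r by (rule rtrancl_trans)
  then show ?thesis
    by (auto simp: strongly_connected_def reachable_matrix_digraph_iff R_def)
qed

definition lift_antisymmetric :: "real^'n \<Rightarrow> real^('n + 'n)" where
  "lift_antisymmetric x = (\<chi> k. case k of Inl i \<Rightarrow> x $ i | Inr i \<Rightarrow> - (x $ i))"

lemma sum_UNIV_Plus:
  "(\<Sum>k\<in>UNIV. f k) = (\<Sum>i\<in>UNIV. f (Inl i)) + (\<Sum>j\<in>UNIV. f (Inr j))"
  for f :: "'a::finite + 'b::finite \<Rightarrow> 'c::comm_monoid_add"
  unfolding UNIV_Plus_UNIV[symmetric] by (subst sum.Plus) auto

lemma bar_matrix_lift_antisymmetric:
  "bar_matrix A *v lift_antisymmetric x = lift_antisymmetric (A *v x)"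
  by (auto simp: vec_eq_iff matrix_vector_mult_def lift_antisymmetric_def bar_matrix_def
      sum_UNIV_Plus sum_negf[symmetric] sum.distrib[symmetric] max_def split: sum.split
      intro!: sum.cong)

lemma probability_vector_bar_matrix_row:
  assumes "\<And>i. (\<Sum>j\<in>UNIV. \<bar>A $ i $ j\<bar>) = 1"
  shows "probability_vector (bar_matrix A $ k)"
proof -
  have abs: "max 0 a + max 0 (- a) = \<bar>a\<bar>" "max 0 (- a) + max 0 a = \<bar>a\<bar>" for a :: real
    by auto
  show ?thesis
    by (cases k) (auto simp: probability_vector_def bar_matrix_def sum_UNIV_Plus abs assms
        split: sum.split simp flip: sum.distrib)
qed

section \<open>Exponential convergence\<close>

text \<open>
  With \<open>e = \<delta> \<beta>\<^sup>2 / (4 p)\<close> the decrease \<open>\<delta> \<beta>\<^sup>2 D\<close> is \<open>4 p e D\<close>. The two bounds give the factor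
  \<open>1 - 8 e\<close>, which is below \<open>(1 - e)\<^sup>2\<close>; the square makes \<open>1 - e\<close> a rate for \<open>z\<close> itself.
\<close>

lemma contraction_factor:
  fixes e :: real
  assumes "V \<ge> 0" "e \<ge> 0" "V' + 4 * p * e * D \<le> V" "V \<le> p * D / 2"
  shows "V' \<le> (1 - e)\<^sup>2 * V"
proof -
  have "8 * e * V \<le> 4 * p * e * D"
    using mult_left_mono[OF assms(4), of "8 * e"] assms(2) by (simp add: algebra_simps)
  with assms(3) have "V' \<le> V - 8 * e * V"
    by linarith
  also have "\<dots> \<le> V - 2 * e * V + e\<^sup>2 * V"
    using assms(1,2) by (simp add: mult_right_mono)
  also have "\<dots> = (1 - e)\<^sup>2 * V"
    by (simp add: power2_eq_square algebra_simps)
  finally show ?thesis .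
qed

text \<open>
  The variance about the conserved mean contracts by \<open>\<rho>\<^sup>2\<close> in each step, and it dominates \<open>\<delta>\<close> times
  the square of every single deviation because no weight is below \<open>\<delta>\<close>. That there are at least two
  indices makes the maximal path length positive and hence \<open>\<rho> < 1\<close>.
\<close>

lemma converges_to_mean_exponentially:
  fixes \<pi> z :: "nat \<Rightarrow> real^'m::finite" and S :: "nat \<Rightarrow> real^'m^'m"
  assumes \<pi>: "absolute_probability_sequence S \<pi>"
    and rows: "\<And>t i. t \<ge> 1 \<Longrightarrow> probability_vector (S t $ i)"
    and diag: "\<And>t i. t \<ge> 1 \<Longrightarrow> S t $ i $ i \<noteq> 0"
    and entries: "\<And>t i j. t \<ge> 1 \<Longrightarrow> S t $ i $ j \<noteq> 0 \<Longrightarrow> \<beta> \<le> S t $ i $ j"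
    and \<delta>: "\<And>t i. t \<ge> 1 \<Longrightarrow> \<delta> \<le> \<pi> t $ i"
    and pos: "\<beta> > 0" "\<delta> > 0" and card: "CARD('m) > 1"
    and sc: "\<And>t. t \<ge> 1 \<Longrightarrow> strongly_connected (matrix_digraph (S t))"
    and z: "\<And>t. t \<ge> 1 \<Longrightarrow> z (t + 1) = S t *v z t"
  defines "\<rho> \<equiv> 1 - \<delta> * \<beta>\<^sup>2 / (4 * real (max_path_length S))"
  shows "0 < \<rho>" "\<rho> < 1"
    and "\<exists>K\<ge>0. \<forall>t\<ge>1. \<forall>i. \<bar>z t $ i - \<pi> 1 \<bullet> z 1\<bar> \<le> K * \<rho> ^ t"
proof -
  define p where "p = real (max_path_length S)"
  define e where "e = \<delta> * \<beta>\<^sup>2 / (4 * p)"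
  have p: "p \<ge> 1"
    using max_path_length_pos[of S, OF sc card] by (simp add: p_def)
  have prob: "probability_vector (\<pi> t)" if "t \<ge> 1" for t
    using \<pi> that unfolding absolute_probability_sequence_def by blast
  have entry_le: "w $ i \<le> 1" if "probability_vector w" for w :: "real^'m" and i
  proof -
    have "w $ i \<le> (\<Sum>i\<in>UNIV. w $ i)"
      using that by (intro member_le_sum) (auto simp: probability_vector_def)
    with that show ?thesis
      by (simp add: probability_vector_def)
  qed
  have "\<delta> \<le> 1"
    using \<delta>[of 1] entry_le[OF prob[of 1]] by (meson order.trans order.refl)
  moreover have "\<beta> \<le> 1"
    using entries[of 1, OF _ diag[of 1]] entry_le[OF rows[of 1]] by (meson order.trans order.refl)
  ultimately have "\<delta> * \<beta>\<^sup>2 \<le> 1"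
    using pos by (simp add: mult_le_one power_le_one)
  then have e: "0 < e" "e < 1" and \<rho>: "\<rho> = 1 - e"
    using p pos by (auto simp: e_def \<rho>_def p_def divide_less_eq)
  then show "0 < \<rho>" "\<rho> < 1"
    by auto
  define V where "V = (\<lambda>t. variance (\<pi> t) (z t))"
  have V_nonneg: "V t \<ge> 0" if "t \<ge> 1" for t
    using prob[OF that] by (auto simp: V_def variance_eq_deviation probability_vector_def
        intro!: sum_nonneg)
  have V_step: "V (t + 1) \<le> \<rho>\<^sup>2 * V t" if t: "t \<ge> 1" for t
    unfolding \<rho>
  proof (rule contraction_factor)
    show "V (t + 1) + 4 * p * e * disagreement (S t) (z t) \<le> V t"
      using variance_decrease[OF \<pi> t rows[OF t] diag[OF t] entries[OF t] _ \<delta>, of "z t"] pos p t z[OF t]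
      by (simp add: V_def e_def)
    show "V t \<le> p * disagreement (S t) (z t) / 2"
      unfolding V_def p_def
      using sq_diff_le_disagreement[OF sc t] by (intro variance_le_max_gap prob t)
  qed (use e V_nonneg t in auto)
  \<comment> \<open>The factor \<open>\<rho>\<^sup>2\<close> on the left compensates for time starting at 1.\<close>
  have V_bound: "V t * \<rho>\<^sup>2 \<le> V 1 * (\<rho> ^ t)\<^sup>2" if "t \<ge> 1" for t
    using that
  proof (induction t rule: dec_induct)
    case (step t)
    have "V (Suc t) * \<rho>\<^sup>2 \<le> \<rho>\<^sup>2 * (V t * \<rho>\<^sup>2)"
      using V_step[of t] step.hyps mult_right_mono[of "V (t + 1)" "\<rho>\<^sup>2 * V t" "\<rho>\<^sup>2"]
      by (simp add: mult.assoc)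
    also have "\<dots> \<le> \<rho>\<^sup>2 * (V 1 * (\<rho> ^ t)\<^sup>2)"
      using step.IH by (intro mult_left_mono) auto
    finally show ?case
      by (simp add: power2_eq_square mult_ac)
  qed simp
  have mean: "\<pi> t \<bullet> z t = \<pi> 1 \<bullet> z 1" if "t \<ge> 1" for t
    using that by (induction t rule: dec_induct) (use mean_step[OF \<pi>] z in auto)
  define K where "K = sqrt (V 1 / \<delta>) / \<rho>"
  have "\<bar>z t $ i - \<pi> 1 \<bullet> z 1\<bar> \<le> K * \<rho> ^ t" if t: "t \<ge> 1" for t i
  proof -
    have "\<delta> * (z t $ i - \<pi> 1 \<bullet> z 1)\<^sup>2 \<le> \<pi> t $ i * (z t $ i - \<pi> t \<bullet> z t)\<^sup>2"
      unfolding mean[OF t] using \<delta>[OF t] by (intro mult_right_mono) auto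
    also have "\<dots> \<le> V t"
      unfolding V_def variance_eq_deviation[OF prob[OF t]]
      using prob[OF t] by (intro member_le_sum) (auto simp: probability_vector_def)
    finally have "\<delta> * (z t $ i - \<pi> 1 \<bullet> z 1)\<^sup>2 * \<rho>\<^sup>2 \<le> V 1 * (\<rho> ^ t)\<^sup>2"
      using V_bound[OF t] by (meson mult_right_mono order.trans zero_le_power2)
    also have "\<dots> = \<delta> * (K * \<rho> ^ t)\<^sup>2 * \<rho>\<^sup>2"
      using pos V_nonneg[of 1] \<open>0 < \<rho>\<close> by (simp add: K_def power_mult_distrib power_divide)
    finally have "(z t $ i - \<pi> 1 \<bullet> z 1)\<^sup>2 \<le> (K * \<rho> ^ t)\<^sup>2"
      using pos \<open>0 < \<rho>\<close> by simp
    moreover have "K * \<rho> ^ t \<ge> 0"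
      using pos V_nonneg[of 1] \<open>0 < \<rho>\<close> by (simp add: K_def)
    ultimately show ?thesis
      by (simp add: abs_le_square_iff[symmetric])
  qed
  moreover have "K \<ge> 0"
    using pos V_nonneg[of 1] \<open>0 < \<rho>\<close> by (simp add: K_def)
  ultimately show "\<exists>K\<ge>0. \<forall>t\<ge>1. \<forall>i. \<bar>z t $ i - \<pi> 1 \<bullet> z 1\<bar> \<le> K * \<rho> ^ t"
    by blast
qed

theorem proposition3:
  fixes A :: "nat \<Rightarrow> real^'n^'n"
    and \<beta> \<delta> :: real
    and \<pi> :: "nat \<Rightarrow> real^('n + 'n)"
  assumes "CARD('n) > 1"
    and "\<And>t i. t \<ge> 1 \<Longrightarrow> A t $ i $ i > 0"
    and "\<And>t i. t \<ge> 1 \<Longrightarrow> (\<Sum>j\<in>UNIV. \<bar>A t $ i $ j\<bar>) = 1"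
    and "\<beta> > 0"
    and "\<And>t i j. t \<ge> 1 \<Longrightarrow> \<bar>A t $ i $ j\<bar> > 0 \<Longrightarrow> \<bar>A t $ i $ j\<bar> \<ge> \<beta>"
    and "\<And>t. t \<ge> 1 \<Longrightarrow> strongly_connected (matrix_digraph (A t))"
    and "\<And>t. t \<ge> 1 \<Longrightarrow> \<not> structurally_balanced (matrix_digraph (A t)) (arc_sign (A t))"
    and "absolute_probability_sequence (\<lambda>t. bar_matrix (A t)) \<pi>"
    and "\<delta> > 0"
    and "\<And>t i. t \<ge> 1 \<Longrightarrow> \<pi> t $ i \<ge> \<delta>"
  defines "\<rho> \<equiv> 1 - \<delta> * \<beta>\<^sup>2 / (4 * real (max_path_length (\<lambda>t. bar_matrix (A t))))"
  shows "\<forall>x :: nat \<Rightarrow> real^'n. (\<forall>t\<ge>1. x (t + 1) = A t *v x t) \<longrightarrow>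
           (\<exists>C\<ge>0. \<forall>t\<ge>1. norm (x t) \<le> C * \<rho> ^ t)"
proof (intro allI impI)
  fix x :: "nat \<Rightarrow> real^'n"
  assume x: "\<forall>t\<ge>1. x (t + 1) = A t *v x t"
  define z where "z = (\<lambda>t. lift_antisymmetric (x t))"
  define c where "c = \<pi> 1 \<bullet> z 1"
  have z: "z (t + 1) = bar_matrix (A t) *v z t" if "t \<ge> 1" for t
    using x that by (simp add: z_def bar_matrix_lift_antisymmetric)
  have diag: "bar_matrix (A t) $ k $ k \<noteq> 0" if "t \<ge> 1" for t k
    using assms(2)[OF that] by (cases k) (auto simp: bar_matrix_def max_def less_le)
  have entries: "\<beta> \<le> bar_matrix (A t) $ k $ l" if "t \<ge> 1" "bar_matrix (A t) $ k $ l \<noteq> 0" for t k l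
  proof -
    obtain i j where "bar_matrix (A t) $ k $ l = max 0 (A t $ i $ j) \<or>
        bar_matrix (A t) $ k $ l = max 0 (- (A t $ i $ j))"
      by (cases k; cases l) (auto simp: bar_matrix_def)
    with that show ?thesis
      using assms(5)[of t i j] by (auto simp: max_def split: if_splits)
  qed
  have card: "CARD('n + 'n) > 1"
    using assms(1) by simp
  have sc: "strongly_connected (matrix_digraph (bar_matrix (A t)))" if "t \<ge> 1" for t
    using assms(6,7)[OF that] by (rule strongly_connected_bar_matrix)
  have rows: "probability_vector (bar_matrix (A t) $ k)" if "t \<ge> 1" for t k
    using assms(3)[OF that] by (rule probability_vector_bar_matrix_row)
  note lim = converges_to_mean_exponentially[where S = "\<lambda>t. bar_matrix (A t)" and z = z,
      OF assms(8) rows diag entries assms(10) assms(4,9) card sc z, folded \<rho>_def c_def]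
  have \<rho>: "0 < \<rho>" "\<rho> < 1"
    using lim(1,2) by blast+
  obtain K where K: "K \<ge> 0" "\<And>t k. t \<ge> 1 \<Longrightarrow> \<bar>z t $ k - c\<bar> \<le> K * \<rho> ^ t"
    using lim(3) by blast
  have near: "\<bar>x t $ i - c\<bar> \<le> K * \<rho> ^ t" "\<bar>x t $ i + c\<bar> \<le> K * \<rho> ^ t" if "t \<ge> 1" for t i
    using K(2)[OF that, of "Inl i"] K(2)[OF that, of "Inr i"]
    by (auto simp: z_def lift_antisymmetric_def)
  \<comment> \<open>The two sheets approach the same limit with opposite signs, so that limit vanishes.\<close>
  have "\<bar>c\<bar> \<le> K * \<rho> ^ t" if "t \<ge> 1" for t
    using near[OF that, of undefined] by linarith
  moreover have "(\<lambda>t. K * \<rho> ^ t) \<longlonglongrightarrow> 0"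
    using \<rho> by (intro tendsto_mult_right_zero LIMSEQ_power_zero) auto
  ultimately have "\<bar>c\<bar> \<le> 0"
    by (intro LIMSEQ_le_const[of "\<lambda>t. K * \<rho> ^ t"]) auto
  then have "norm (x t) \<le> (real CARD('n) * K) * \<rho> ^ t" if "t \<ge> 1" for t
  proof -
    have "norm (x t) \<le> (\<Sum>i\<in>UNIV. \<bar>x t $ i\<bar>)"
      by (rule norm_le_l1_cart)
    also have "\<dots> \<le> (\<Sum>i\<in>(UNIV :: 'n set). K * \<rho> ^ t)"
      using near(1)[OF that] \<open>\<bar>c\<bar> \<le> 0\<close> by (intro sum_mono) simp
    finally show ?thesis
      by simp
  qed
  with K(1) show "\<exists>C\<ge>0. \<forall>t\<ge>1. norm (x t) \<le> C * \<rho> ^ t"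
    by (intro exI[of _ "real CARD('n) * K"]) simp
qed

end
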